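(* Let $G$ be a simple connected graph on $[n]$ such that its Laplacian simplex $\mathcal{P}_G$ is reflexive, and let $L(n)$ be its Laplacian matrix with the $n$-th column deleted. Then \[ \Lambda(\mathcal{P}_G)=\left\{\frac{\mathbf{x}}{n}\;\middle|\;\mathbf{x}\in\mathbb{Z}^n,\ 0\le x_i<n \text{ for all } i,\ \mathbf{x}\cdot[L(n)\mid\mathbb{1}]\equiv\mathbf{0}\bmod n\right\}. \]
   Context: The Laplacian matrix $L$ of a simple graph on $[n]$ has $L_{ii}=\deg(i)$, $L_{ij}=-1$ if $\{i,j\}$ is an edge and $0$ otherwise. The Laplacian simplex $\mathcal{P}_G\subset\mathbb{R}^{n-1}$ is the convex hull of the rows of $L(n)$, ordered as vertices $\mathbf{v}_1,\dots,\mathbf{v}_n$. A lattice polytope is reflexive if it contains the origin in its interior and its dual $\{\mathbf{x}\mid \mathbf{x}\mathbf{y}^T\le 1\ \forall\mathbf{y}\in\mathcal{P}\}$ is a lattice polytope. $[L(n)\mid\mathbb{1}]$ is $L(n)$ with a column of ones appended. For a lattice simplex with ordered vertices $\mathbf{v}_1,\dots,\mathbf{v}_{d+1}$, $\Lambda(\mathcal{P})$ is the set of $\lambda\in[0,1)^{d+1}$ with $\sum_i\lambda_i(\mathbf{v}_i,1)\in\mathbb{Z}^{d+1}$. *)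

theory Defs
  imports "Jordan_Normal_Form.Matrix" "HOL-Number_Theory.Cong"
begin

text \<open>
  Conventions: the vertex set $[n]$ is rendered as \<open>{0..<n}\<close>, so that vertices are row and column
  indices of matrices; the $n$-th vertex (column) has index \<open>n - 1\<close>. The space $\mathbb{R}^d$ is
  \<open>carrier_vec d :: real vec set\<close>. As \<open>real vec\<close> is not a type of vectors of one fixed dimension, it
  has no type-class convex hull or topology, so these are defined relative to the dimension \<open>d\<close>.
\<close>

definition simple_graph :: "nat \<Rightarrow> nat set set \<Rightarrow> bool" where
  "simple_graph n E \<longleftrightarrow> (\<forall>e\<in>E. e \<subseteq> {0..<n} \<and> card e = 2)"

definition connected_graph :: "nat \<Rightarrow> nat set set \<Rightarrow> bool" where
  "connected_graph n E \<longleftrightarrow> (\<forall>u\<in>{0..<n}. \<forall>v\<in>{0..<n}. (u, v) \<in> {(a, b). {a, b} \<in> E}\<^sup>*)"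

definition degree :: "nat set set \<Rightarrow> nat \<Rightarrow> nat" where
  "degree E i = card {e \<in> E. i \<in> e}"

definition laplacian :: "nat \<Rightarrow> nat set set \<Rightarrow> int mat" where
  "laplacian n E = mat n n (\<lambda>(i, j).
     if i = j then int (degree E i) else if {i, j} \<in> E then - 1 else 0)"

text \<open>$L(n)$\<close>

definition laplacian_del :: "nat \<Rightarrow> nat set set \<Rightarrow> int mat" where
  "laplacian_del n E = mat n (n - 1) (\<lambda>(i, j). laplacian n E $$ (i, j))"

text \<open>$[A \mid \mathbb{1}]$\<close>

definition append_ones :: "int mat \<Rightarrow> int mat" where
  "append_ones A = mat (dim_row A) (dim_col A + 1)
     (\<lambda>(i, j). if j < dim_col A then A $$ (i, j) else 1)"

definition convex_hull_vec :: "nat \<Rightarrow> real vec set \<Rightarrow> real vec set" where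
  "convex_hull_vec d S = {finsum_vec TYPE(real) d (\<lambda>v. c v \<cdot>\<^sub>v v) T | T c.
     finite T \<and> T \<subseteq> S \<and> (\<forall>v\<in>T. 0 \<le> c v) \<and> sum c T = 1}"

definition interior_vec :: "nat \<Rightarrow> real vec set \<Rightarrow> real vec set" where
  "interior_vec d S = {a \<in> carrier_vec d.
     \<exists>\<epsilon>>0. \<forall>x\<in>carrier_vec d. sqrt ((x - a) \<bullet> (x - a)) < \<epsilon> \<longrightarrow> x \<in> S}"

definition lattice_points :: "nat \<Rightarrow> real vec set" where
  "lattice_points d = {v \<in> carrier_vec d. \<forall>i<d. v $ i \<in> \<int>}"

definition lattice_polytope :: "nat \<Rightarrow> real vec set \<Rightarrow> bool" where
  "lattice_polytope d P \<longleftrightarrow> (\<exists>S. finite S \<and> S \<subseteq> lattice_points d \<and> P = convex_hull_vec d S)"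

definition dual_polytope :: "nat \<Rightarrow> real vec set \<Rightarrow> real vec set" where
  "dual_polytope d P = {x \<in> carrier_vec d. \<forall>y\<in>P. x \<bullet> y \<le> 1}"

definition reflexive :: "nat \<Rightarrow> real vec set \<Rightarrow> bool" where
  "reflexive d P \<longleftrightarrow>
     lattice_polytope d P \<and> 0\<^sub>v d \<in> interior_vec d P \<and> lattice_polytope d (dual_polytope d P)"

definition laplacian_vertex :: "nat \<Rightarrow> nat set set \<Rightarrow> nat \<Rightarrow> real vec" where
  "laplacian_vertex n E i = map_vec real_of_int (row (laplacian_del n E) i)"

definition laplacian_simplex :: "nat \<Rightarrow> nat set set \<Rightarrow> real vec set" where
  "laplacian_simplex n E = convex_hull_vec (n - 1) (laplacian_vertex n E ` {0..<n})"

text \<open>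
  \<open>\<Lambda>\<close> depends on the ordering of the vertices, so it takes the ordered vertices
  \<open>v 0, \<dots>, v d\<close> of a simplex in $\mathbb{R}^d$ rather than the simplex as a set.
\<close>

definition Lambda :: "nat \<Rightarrow> (nat \<Rightarrow> real vec) \<Rightarrow> real vec set" where
  "Lambda d v = {l \<in> carrier_vec (d + 1). (\<forall>i<d + 1. 0 \<le> l $ i \<and> l $ i < 1) \<and>
     finsum_vec TYPE(real) (d + 1) (\<lambda>i. l $ i \<cdot>\<^sub>v (v i @\<^sub>v vec_of_list [1])) {0..<d + 1}
       \<in> lattice_points (d + 1)}"

end

theory Submission
  imports Defs "Jordan_Normal_Form.Determinant"
begin

text \<open>
  The rows $v_j$ of $L(n)$ sum to zero, and since the origin is interior to the simplex there is, for
  every $i$, a point $u_i$ of the dual with $u_i \cdot v_j = 1$ for $j \neq i$, and hence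
  $u_i \cdot v_i = 1 - n$. As the dual is a lattice polytope, $u_i$ can be taken to be a lattice point.
  If $\lambda \in \Lambda$, pairing the integral vector $\sum_j \lambda_j v_j$ with $u_i$ gives
  $\sum_j \lambda_j - n \lambda_i$, so $n \lambda_i$ is an integer.
\<close>

section \<open>Scalar products with points of a convex hull\<close>

lemma scalar_prod_finsum_vec:
  fixes w :: "'a :: comm_semiring_0 vec"
  assumes "finite F" "w \<in> carrier_vec d" "f \<in> F \<rightarrow> carrier_vec d"
  shows "w \<bullet> finsum_vec TYPE('a) d f F = (\<Sum>x\<in>F. w \<bullet> f x)"
proof -
  have "finsum_vec TYPE('a) d f F \<in> carrier_vec d"
    using finsum_vec_closed[OF assms(3)] .
  then have "w \<bullet> finsum_vec TYPE('a) d f F = (\<Sum>k = 0..<d. w $ k * (\<Sum>x\<in>F. f x $ k))"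
    unfolding scalar_prod_def by (auto intro!: sum.cong simp: index_finsum_vec[OF assms(1) _ assms(3)])
  also have "\<dots> = (\<Sum>x\<in>F. \<Sum>k = 0..<d. w $ k * f x $ k)"
    unfolding sum_distrib_left by (rule sum.swap)
  also have "\<dots> = (\<Sum>x\<in>F. w \<bullet> f x)"
    using assms(3) unfolding scalar_prod_def
    by (intro sum.cong refl) (auto dest!: Pi_mem simp: carrier_vecD)
  finally show ?thesis .
qed

text \<open>A hull point is accessed only through its scalar products, which are weighted averages
  of those of the generators. Later arguments thus never unfold \<open>finsum_vec\<close> over a
  hull.\<close>

lemma convex_hull_vecE:
  assumes "y \<in> convex_hull_vec d S" "S \<subseteq> carrier_vec d"
  obtains T c where "finite T" "T \<subseteq> S" "\<And>v. v \<in> T \<Longrightarrow> 0 \<le> c v" "sum c T = 1"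
    and "\<And>w. w \<in> carrier_vec d \<Longrightarrow> w \<bullet> y = (\<Sum>v\<in>T. c v * (w \<bullet> v))"
proof -
  from assms(1) obtain T c where T: "finite T" "T \<subseteq> S" "\<forall>v\<in>T. 0 \<le> c v" "sum c T = 1"
    and y: "y = finsum_vec TYPE(real) d (\<lambda>v. c v \<cdot>\<^sub>v v) T"
    unfolding convex_hull_vec_def by blast
  have "w \<bullet> y = (\<Sum>v\<in>T. c v * (w \<bullet> v))" if w: "w \<in> carrier_vec d" for w
  proof -
    have "w \<bullet> y = (\<Sum>v\<in>T. w \<bullet> (c v \<cdot>\<^sub>v v))"
      unfolding y using T assms(2) w by (intro scalar_prod_finsum_vec) auto
    also have "\<dots> = (\<Sum>v\<in>T. c v * (w \<bullet> v))"
      using T assms(2) w by (intro sum.cong refl scalar_prod_smult_distrib) auto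
    finally show ?thesis .
  qed
  with T show thesis by (intro that) auto
qed

lemma scalar_prod_le_convex_hull_vec:
  assumes "y \<in> convex_hull_vec d S" "S \<subseteq> carrier_vec d" "w \<in> carrier_vec d"
    and le: "\<And>v. v \<in> S \<Longrightarrow> w \<bullet> v \<le> b"
  shows "w \<bullet> y \<le> b"
proof -
  obtain T c where T: "finite T" "T \<subseteq> S" "\<And>v. v \<in> T \<Longrightarrow> 0 \<le> c v" "sum c T = 1"
    and y: "\<And>w. w \<in> carrier_vec d \<Longrightarrow> w \<bullet> y = (\<Sum>v\<in>T. c v * (w \<bullet> v))"
    using convex_hull_vecE[OF assms(1,2)] by blast
  have "w \<bullet> y \<le> (\<Sum>v\<in>T. c v * b)"
    unfolding y[OF assms(3)] using T le by (intro sum_mono mult_left_mono) auto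
  also have "\<dots> = b"
    using T by (simp flip: sum_distrib_right)
  finally show ?thesis .
qed

lemma subset_convex_hull_vec:
  assumes "S \<subseteq> carrier_vec d"
  shows "S \<subseteq> convex_hull_vec d S"
proof
  fix s assume s: "s \<in> S"
  have "finsum_vec TYPE(real) d (\<lambda>v. 1 \<cdot>\<^sub>v v) {s} = s"
  proof (rule eq_vecI)
    show "dim_vec (finsum_vec TYPE(real) d (\<lambda>v. 1 \<cdot>\<^sub>v v) {s}) = dim_vec s"
      using s assms finsum_vec_closed[of "\<lambda>v. 1 \<cdot>\<^sub>v v" "{s}" d] by auto
    show "finsum_vec TYPE(real) d (\<lambda>v. 1 \<cdot>\<^sub>v v) {s} $ i = s $ i" if "i < dim_vec s" for i
      using that s assms by (subst index_finsum_vec) auto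
  qed
  with s show "s \<in> convex_hull_vec d S"
    unfolding convex_hull_vec_def
    by (intro CollectI exI[of _ "{s}"] exI[of _ "\<lambda>_. 1"]) auto
qed

text \<open>Take a generator \<open>s\<close> of nonzero weight in a convex combination for
  \<open>y\<close>. If \<open>w\<close> is bounded by \<open>b\<close> on \<open>S\<close> and
  equals \<open>b\<close> at \<open>y\<close>, then the weighted sum of the nonnegative gaps
  \<open>b - w \<bullet> v\<close> is zero, so the gap at \<open>s\<close> is zero. As
  \<open>s\<close> is chosen before \<open>w\<close>, it lies on all supporting hyperplanes through
  \<open>y\<close> at once.\<close>

lemma convex_hull_vec_face_generator:
  assumes y: "y \<in> convex_hull_vec d S" and S: "S \<subseteq> carrier_vec d"
  obtains s where "s \<in> S"
    and "\<And>w b. \<lbrakk>w \<in> carrier_vec d; \<And>v. v \<in> S \<Longrightarrow> w \<bullet> v \<le> b; w \<bullet> y = b\<rbrakk> \<Longrightarrow> w \<bullet> s = b"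
proof -
  obtain T c where T: "finite T" "T \<subseteq> S" "\<And>v. v \<in> T \<Longrightarrow> 0 \<le> c v" "sum c T = 1"
    and y: "\<And>w. w \<in> carrier_vec d \<Longrightarrow> w \<bullet> y = (\<Sum>v\<in>T. c v * (w \<bullet> v))"
    using convex_hull_vecE[OF assms] by blast
  from T(4) obtain s where s: "s \<in> T" "c s \<noteq> 0"
    by (metis sum.neutral zero_neq_one)
  have "w \<bullet> s = b" if w: "w \<in> carrier_vec d" and le: "\<And>v. v \<in> S \<Longrightarrow> w \<bullet> v \<le> b" and eq: "w \<bullet> y = b"
    for w b
  proof -
    have "(\<Sum>v\<in>T. c v * (b - w \<bullet> v)) = sum c T * b - (\<Sum>v\<in>T. c v * (w \<bullet> v))"
      by (simp add: sum_subtractf sum_distrib_right right_diff_distrib)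
    also have "\<dots> = 0"
      using T(4) eq y[OF w] by simp
    finally have "(\<Sum>v\<in>T. c v * (b - w \<bullet> v)) = 0" .
    moreover have "0 \<le> c v * (b - w \<bullet> v)" if "v \<in> T" for v
      using that T le by (intro mult_nonneg_nonneg) auto
    ultimately have "c s * (b - w \<bullet> s) = 0"
      using s T(1) by (auto simp: sum_nonneg_eq_0_iff)
    with s show ?thesis by simp
  qed
  moreover have "s \<in> S" using s(1) T(2) by blast
  ultimately show thesis by (rule that[rotated])
qed

text \<open>If \<open>u\<close> is nonzero, a small positive multiple of it lies in the hull and has
  positive scalar product with \<open>u\<close>. But \<open>u\<close> vanishes on the generators, so
  it is at most 0 on the hull.\<close>

lemma orthogonal_to_neighborhood_of_0:
  assumes int: "0\<^sub>v d \<in> interior_vec d (convex_hull_vec d S)" and S: "S \<subseteq> carrier_vec d"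
    and u: "u \<in> carrier_vec d" and orth: "\<And>v. v \<in> S \<Longrightarrow> u \<bullet> v = 0"
  shows "u = 0\<^sub>v d"
proof (rule ccontr)
  assume "u \<noteq> 0\<^sub>v d"
  moreover have uu: "u \<bullet> u = (\<Sum>k = 0..<d. (u $ k)\<^sup>2)"
    using u by (simp add: scalar_prod_def power2_eq_square)
  moreover have "\<exists>k<d. u $ k \<noteq> 0"
    using \<open>u \<noteq> 0\<^sub>v d\<close> u by (metis carrier_vecD eq_vecI index_zero_vec)
  ultimately have pos: "u \<bullet> u > 0"
    by (auto intro!: sum_pos2 simp: uu)
  from int obtain e where e: "e > 0"
    and ball: "\<And>x. x \<in> carrier_vec d \<Longrightarrow> sqrt ((x - 0\<^sub>v d) \<bullet> (x - 0\<^sub>v d)) < e \<Longrightarrow> x \<in> convex_hull_vec d S"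
    unfolding interior_vec_def by blast
  \<comment> \<open>This scaling gives \<open>r \<cdot>\<^sub>v u\<close> length
    \<open>e / 2\<close>, inside the ball around the origin.\<close>
  define r where "r = e / (2 * sqrt (u \<bullet> u))"
  have r: "r > 0" using e pos by (simp add: r_def)
  have "sqrt ((r \<cdot>\<^sub>v u) \<bullet> (r \<cdot>\<^sub>v u)) = r * sqrt (u \<bullet> u)"
    using u r by (simp add: real_sqrt_mult)
  also have "\<dots> < e"
    using e pos by (simp add: r_def)
  finally have "r \<cdot>\<^sub>v u \<in> convex_hull_vec d S"
    using u by (intro ball) auto
  then have "u \<bullet> (r \<cdot>\<^sub>v u) \<le> 0"
    by (rule scalar_prod_le_convex_hull_vec[OF _ S u]) (simp add: orth)
  with u r pos show False
    by (simp add: mult_le_0_iff)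
qed

section \<open>Coordinates of \<open>Lambda\<close> for ordered vertices
  \<open>v 0, ..., v d\<close>\<close>

context
  fixes d :: nat and v :: "nat \<Rightarrow> real vec"
  assumes v: "\<And>i. i < d + 1 \<Longrightarrow> v i \<in> carrier_vec d"
begin

lemma dim_v: "i < d + 1 \<Longrightarrow> dim_vec (v i) = d"
  using v carrier_vecD by blast

text \<open>The lattice condition is split into the \<open>d\<close> coordinates of the combination
  of the \<open>v i\<close> and the appended coordinate, which is the sum of the
  coefficients.\<close>

lemma mem_Lambda_iff:
  "l \<in> Lambda d v \<longleftrightarrow> l \<in> carrier_vec (d + 1) \<and> (\<forall>i<d + 1. 0 \<le> l $ i \<and> l $ i < 1) \<and>
     (\<forall>j<d. (\<Sum>i = 0..<d + 1. l $ i * v i $ j) \<in> \<int>) \<and> (\<Sum>i = 0..<d + 1. l $ i) \<in> \<int>"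
proof -
  define f where "f i = l $ i \<cdot>\<^sub>v (v i @\<^sub>v vec_of_list [1])" for i
  have dim_f: "dim_vec (f i) = d + 1" if "i < d + 1" for i
    using that by (simp add: f_def dim_v)
  have f: "f \<in> {0..<d + 1} \<rightarrow> carrier_vec (d + 1)"
    by (intro Pi_I carrier_vecI) (simp add: dim_f)
  have "finsum_vec TYPE(real) (d + 1) f {0..<d + 1} $ j = (\<Sum>i = 0..<d + 1. l $ i * v i $ j)"
    if "j < d" for j
    using that by (subst index_finsum_vec[OF _ _ f]) (auto intro!: sum.cong simp: f_def dim_v)
  moreover have "finsum_vec TYPE(real) (d + 1) f {0..<d + 1} $ d = (\<Sum>i = 0..<d + 1. l $ i)"
  proof -
    have "f i $ d = l $ i" if "i < d + 1" for i
      using that by (simp add: f_def dim_v)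
    then show ?thesis
      by (subst index_finsum_vec[OF _ _ f]) auto
  qed
  moreover have "finsum_vec TYPE(real) (d + 1) f {0..<d + 1} \<in> carrier_vec (d + 1)"
    using finsum_vec_closed[OF f] .
  ultimately have "finsum_vec TYPE(real) (d + 1) f {0..<d + 1} \<in> lattice_points (d + 1) \<longleftrightarrow>
    (\<forall>j<d. (\<Sum>i = 0..<d + 1. l $ i * v i $ j) \<in> \<int>) \<and> (\<Sum>i = 0..<d + 1. l $ i) \<in> \<int>"
    by (auto simp: lattice_points_def All_less_Suc)
  then show ?thesis
    unfolding Lambda_def f_def by simp
qed

section \<open>Reflexive simplices whose vertices sum to zero\<close>

context
  assumes centered: "\<And>j. j < d \<Longrightarrow> (\<Sum>i = 0..<d + 1. v i $ j) = 0"
begin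

lemma sum_scalar_prod_centered:
  assumes "u \<in> carrier_vec d"
  shows "(\<Sum>j = 0..<d + 1. u \<bullet> v j) = 0"
proof -
  have "(\<Sum>j = 0..<d + 1. u \<bullet> v j) = (\<Sum>j = 0..<d + 1. \<Sum>k = 0..<d. u $ k * v j $ k)"
    unfolding scalar_prod_def by (intro sum.cong) (auto simp: dim_v)
  also have "\<dots> = (\<Sum>k = 0..<d. u $ k * (\<Sum>j = 0..<d + 1. v j $ k))"
    unfolding sum_distrib_left by (rule sum.swap)
  also have "\<dots> = 0"
    using centered by (intro sum.neutral ballI) simp
  finally show ?thesis .
qed

text \<open>Since the vertices sum to zero, the values 1 at the other \<open>d\<close> vertices
  force the value \<open>- real d\<close> at \<open>v i\<close>. The conditions are
  \<open>d + 1\<close> equations in \<open>d\<close> unknowns; an extra unknown with a column of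
  ones makes the system square. It is nonsingular, and the extra unknown is zero in the solution
  because the right-hand side sums to zero.\<close>

lemma dual_facet_point:
  assumes int: "0\<^sub>v d \<in> interior_vec d (convex_hull_vec d (v ` {0..<d + 1}))" and i: "i < d + 1"
  obtains u where "u \<in> carrier_vec d"
    and "\<And>j. j < d + 1 \<Longrightarrow> u \<bullet> v j = (if j = i then - real d else 1)"
proof -
  define M where "M = mat (d + 1) (d + 1) (\<lambda>(j, k). if k < d then v j $ k else 1)"
  have M: "M \<in> carrier_mat (d + 1) (d + 1)"
    by (simp add: M_def)
  have Mz: "(M *\<^sub>v z) $ j = vec d (($) z) \<bullet> v j + z $ d"
    if "z \<in> carrier_vec (d + 1)" "j < d + 1" for z j
    using that by (simp add: M_def scalar_prod_def mult.commute dim_v)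
  \<comment> \<open>Adding all rows of \<open>M *\<^sub>v z\<close> cancels the vertex part by
    centering and leaves \<open>d + 1\<close> times the extra unknown.\<close>
  have zd: "z $ d = 0" if z: "z \<in> carrier_vec (d + 1)" and s: "(\<Sum>j = 0..<d + 1. (M *\<^sub>v z) $ j) = 0" for z
  proof -
    have "(\<Sum>j = 0..<d + 1. (M *\<^sub>v z) $ j) = (\<Sum>j = 0..<d + 1. vec d (($) z) \<bullet> v j + z $ d)"
      using z by (intro sum.cong) (auto simp: Mz)
    also have "\<dots> = real (d + 1) * z $ d"
      unfolding sum.distrib by (subst sum_scalar_prod_centered) auto
    finally show ?thesis using s by simp
  qed
  \<comment> \<open>The extra unknown of a kernel vector is zero, so its first \<open>d\<close>
    entries form a vector orthogonal to all vertices. That vector is zero because the origin is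
    interior.\<close>
  have "det M \<noteq> 0"
  proof
    assume "det M = 0"
    then obtain z where z: "z \<in> carrier_vec (d + 1)" "z \<noteq> 0\<^sub>v (d + 1)" "M *\<^sub>v z = 0\<^sub>v (d + 1)"
      using det_0_iff_vec_prod_zero[OF M] by blast
    have d0: "z $ d = 0"
      using z by (intro zd) simp_all
    have "vec d (($) z) \<bullet> v j = 0" if "j < d + 1" for j
      using Mz[OF z(1) that] z(3) that d0 by simp
    then have "vec d (($) z) = 0\<^sub>v d"
      using v by (intro orthogonal_to_neighborhood_of_0[OF int]) auto
    then have "z $ k = 0" if "k < d" for k
      using that by (metis index_vec index_zero_vec(1))
    with d0 have "z = 0\<^sub>v (d + 1)"
      using z(1) by (intro eq_vecI) (auto simp: less_Suc_eq)
    with z(2) show False ..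
  qed
  then obtain B where B: "B \<in> carrier_mat (d + 1) (d + 1)" "M * B = 1\<^sub>m (d + 1)"
    using det_non_zero_imp_unit[OF M, where b = "()"] unfolding Units_def ring_mat_def by auto
  define b where "b = vec (d + 1) (\<lambda>j. if j = i then - real d else 1)"
  define z where "z = B *\<^sub>v b"
  have b: "b \<in> carrier_vec (d + 1)" by (simp add: b_def)
  have z: "z \<in> carrier_vec (d + 1)" using B by (simp add: z_def b_def)
  have Mb: "M *\<^sub>v z = b"
    using B M b by (simp add: z_def flip: assoc_mult_mat_vec)
  \<comment> \<open>Writing each entry as 1 minus \<open>d + 1\<close> at index \<open>i\<close>
    shows that the right-hand side has sum zero.\<close>
  have "(\<Sum>j = 0..<d + 1. b $ j) = (\<Sum>j = 0..<d + 1. 1 - (if j = i then real (d + 1) else 0))"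
    by (intro sum.cong) (auto simp: b_def)
  also have "\<dots> = 0"
    unfolding sum_subtractf using i by simp
  finally have d0: "z $ d = 0"
    using z Mb by (intro zd) simp_all
  show thesis
  proof (rule that)
    show "vec d (($) z) \<bullet> v j = (if j = i then - real d else 1)" if "j < d + 1" for j
      using Mz[OF z that] Mb d0 that by (simp add: b_def)
  qed simp
qed

text \<open>The dual is the hull of a set \<open>S\<close> of lattice points, so \<open>u\<close>
  from \<open>dual_facet_point\<close> can be replaced by some \<open>s\<close> in \<open>S\<close>.
  Each inequality given by \<open>v j\<close> with \<open>j \<noteq> i\<close> is valid on
  \<open>S\<close> and tight at \<open>u\<close>, hence tight at \<open>s\<close>.\<close>

lemma lattice_dual_facet_point:
  assumes refl: "reflexive d (convex_hull_vec d (v ` {0..<d + 1}))" and i: "i < d + 1"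
  obtains s where "s \<in> lattice_points d"
    and "\<And>j. j < d + 1 \<Longrightarrow> s \<bullet> v j = (if j = i then - real d else 1)"
proof -
  let ?P = "convex_hull_vec d (v ` {0..<d + 1})"
  have V: "v ` {0..<d + 1} \<subseteq> carrier_vec d"
    using v by auto
  obtain u where u: "u \<in> carrier_vec d" "\<And>j. j < d + 1 \<Longrightarrow> u \<bullet> v j = (if j = i then - real d else 1)"
    using dual_facet_point[OF _ i] refl unfolding reflexive_def by blast
  obtain S where S: "S \<subseteq> lattice_points d" "dual_polytope d ?P = convex_hull_vec d S"
    using refl unfolding reflexive_def lattice_polytope_def by auto
  have Sc: "S \<subseteq> carrier_vec d"
    using S(1) by (auto simp: lattice_points_def)
  \<comment> \<open>The values of \<open>u\<close> at the vertices are 1 and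
    \<open>- real d\<close>, all at most 1, and this bound passes to the hull.\<close>
  have "u \<in> dual_polytope d ?P"
    unfolding dual_polytope_def using u
    by (auto intro: scalar_prod_le_convex_hull_vec[OF _ V u(1)])
  then obtain s where s: "s \<in> S"
    and face: "\<And>w b. \<lbrakk>w \<in> carrier_vec d; \<And>y. y \<in> S \<Longrightarrow> w \<bullet> y \<le> b; w \<bullet> u = b\<rbrakk> \<Longrightarrow> w \<bullet> s = b"
    using convex_hull_vec_face_generator[OF _ Sc] unfolding S(2) by blast
  have sc: "s \<in> carrier_vec d" using s Sc by auto
  have one: "s \<bullet> v j = 1" if j: "j < d + 1" "j \<noteq> i" for j
  proof -
    \<comment> \<open>The roles are exchanged here: the vertex \<open>v j\<close> is the linear
      functional and the dual is the hull on which it is bounded.\<close>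
    have "v j \<bullet> y \<le> 1" if "y \<in> S" for y
    proof -
      have "y \<in> dual_polytope d ?P" "v j \<in> ?P"
        using that j S(2) subset_convex_hull_vec[OF Sc] subset_convex_hull_vec[OF V] by auto
      then have "y \<bullet> v j \<le> 1" "y \<in> carrier_vec d"
        by (auto simp: dual_polytope_def)
      then show ?thesis
        using comm_scalar_prod v[OF j(1)] by metis
    qed
    moreover have "v j \<bullet> u = 1"
      using u j comm_scalar_prod[OF u(1) v[OF j(1)]] by simp
    ultimately have "v j \<bullet> s = 1"
      using v[OF j(1)] by (intro face)
    then show ?thesis
      using comm_scalar_prod[OF sc v[OF j(1)]] by simp
  qed
  \<comment> \<open>Tightness gave the values at the \<open>d\<close> other vertices; centering
    determines the value at \<open>v i\<close>.\<close>
  have "(\<Sum>j = 0..<d + 1. s \<bullet> v j) = s \<bullet> v i + (\<Sum>j \<in> {0..<d + 1} - {i}. s \<bullet> v j)"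
    using i by (intro sum.remove) auto
  also have "(\<Sum>j \<in> {0..<d + 1} - {i}. s \<bullet> v j) = (\<Sum>j \<in> {0..<d + 1} - {i}. 1)"
    using one by (intro sum.cong) auto
  finally have "s \<bullet> v i = - real d"
    using i sum_scalar_prod_centered[OF sc] by simp
  with one s S(1) show thesis
    by (intro that[of s]) auto
qed

text \<open>The lattice point \<open>s\<close> is paired with the combination of the
  \<open>v j\<close> with coefficients \<open>l $ j\<close>, both having integer coordinates. The
  result differs from the integer sum of the \<open>l $ j\<close> by
  \<open>real (d + 1) * l $ i\<close>.\<close>

lemma reflexive_Lambda_integral:
  assumes refl: "reflexive d (convex_hull_vec d (v ` {0..<d + 1}))"
    and l: "l \<in> Lambda d v" and i: "i < d + 1"
  shows "real (d + 1) * l $ i \<in> \<int>"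
proof -
  obtain s where s: "s \<in> lattice_points d"
    "\<And>j. j < d + 1 \<Longrightarrow> s \<bullet> v j = (if j = i then - real d else 1)"
    using lattice_dual_facet_point[OF refl i] by blast
  have "(\<Sum>k = 0..<d. s $ k * (\<Sum>j = 0..<d + 1. l $ j * v j $ k))
    = (\<Sum>j = 0..<d + 1. \<Sum>k = 0..<d. l $ j * (s $ k * v j $ k))"
    unfolding sum_distrib_left by (subst sum.swap) (simp add: mult.left_commute)
  also have "\<dots> = (\<Sum>j = 0..<d + 1. l $ j * (s \<bullet> v j))"
    by (intro sum.cong) (auto simp: scalar_prod_def sum_distrib_left dim_v)
  \<comment> \<open>The value \<open>- real d\<close> at \<open>j = i\<close> is written as 1 minus
    \<open>d + 1\<close>.\<close>
  also have "\<dots> = (\<Sum>j = 0..<d + 1. l $ j - (if j = i then real (d + 1) * l $ j else 0))"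
    by (intro sum.cong) (auto simp: s(2) algebra_simps)
  also have "\<dots> = (\<Sum>j = 0..<d + 1. l $ j) - real (d + 1) * l $ i"
    unfolding sum_subtractf using i by simp
  finally have eq: "real (d + 1) * l $ i =
    (\<Sum>j = 0..<d + 1. l $ j) - (\<Sum>k = 0..<d. s $ k * (\<Sum>j = 0..<d + 1. l $ j * v j $ k))"
    by simp
  show ?thesis
    unfolding eq using l s(1) unfolding mem_Lambda_iff lattice_points_def
    by (intro Ints_diff Ints_sum[of _ "\<lambda>k. s $ k * _ k"] Ints_mult) auto
qed

end

end

section \<open>Entries and column sums of the Laplacian matrix\<close>

text \<open>Sending \<open>j\<close> to \<open>{i, j}\<close> is a bijection from neighbours to
  incident edges. Surjectivity uses that an edge has exactly two elements, both below
  \<open>n\<close>.\<close>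

lemma degree_eq_card_neighbours:
  assumes "simple_graph n E"
  shows "Defs.degree E i = card {j \<in> {0..<n}. j \<noteq> i \<and> {i, j} \<in> E}"
proof -
  have "bij_betw (\<lambda>j. {i, j}) {j \<in> {0..<n}. j \<noteq> i \<and> {i, j} \<in> E} {e \<in> E. i \<in> e}"
  proof (rule bij_betw_imageI)
    show "inj_on (\<lambda>j. {i, j}) {j \<in> {0..<n}. j \<noteq> i \<and> {i, j} \<in> E}"
      by (auto simp: inj_on_def doubleton_eq_iff)
    have "e \<in> (\<lambda>j. {i, j}) ` {j \<in> {0..<n}. j \<noteq> i \<and> {i, j} \<in> E}" if e: "e \<in> E" "i \<in> e" for e
    proof -
      from e assms have "card e = 2" "e \<subseteq> {0..<n}"
        by (auto simp: simple_graph_def)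
      with e obtain j where "e = {i, j}" "j \<noteq> i"
        by (auto simp: card_2_iff)
      with e \<open>e \<subseteq> {0..<n}\<close> show ?thesis by auto
    qed
    then show "(\<lambda>j. {i, j}) ` {j \<in> {0..<n}. j \<noteq> i \<and> {i, j} \<in> E} = {e \<in> E. i \<in> e}"
      by auto
  qed
  then show ?thesis
    unfolding Defs.degree_def by (simp add: bij_betw_same_card)
qed

text \<open>The degree on the diagonal cancels one entry -1 for each neighbour. This provides the
  centering of the vertices of the Laplacian simplex.\<close>

lemma sum_column_laplacian:
  assumes "simple_graph n E" "j < n"
  shows "(\<Sum>i = 0..<n. laplacian n E $$ (i, j)) = 0"
proof -
  have "(\<Sum>i = 0..<n. laplacian n E $$ (i, j)) =
    (\<Sum>i = 0..<n. (if i = j then int (Defs.degree E j) else 0) - (if i \<noteq> j \<and> {j, i} \<in> E then 1 else 0))"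
    using assms(2) by (intro sum.cong) (auto simp: laplacian_def insert_commute)
  also have "\<dots> = int (Defs.degree E j) - int (card {i \<in> {0..<n}. i \<noteq> j \<and> {j, i} \<in> E})"
    unfolding sum_subtractf using assms(2) by (simp add: sum.If_cases Int_def)
  also have "\<dots> = 0"
    by (simp add: degree_eq_card_neighbours[OF assms(1)])
  finally show ?thesis .
qed

lemma laplacian_vertex_carrier: "i < n \<Longrightarrow> laplacian_vertex n E i \<in> carrier_vec (n - 1)"
  by (simp add: laplacian_vertex_def laplacian_del_def)

lemma index_laplacian_vertex:
  "i < n \<Longrightarrow> j < n - 1 \<Longrightarrow> laplacian_vertex n E i $ j = real_of_int (laplacian n E $$ (i, j))"
  by (simp add: laplacian_vertex_def laplacian_del_def)

text \<open>The row vector product of \<open>x\<close> with the matrix is expressed by the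
  transpose; its last coordinate, from the column of ones, has index \<open>n - 1\<close>.\<close>

lemma index_transpose_append_ones:
  assumes "x \<in> carrier_vec n" "n \<ge> 1" "j < n"
  shows "(transpose_mat (append_ones (laplacian_del n E)) *\<^sub>v x) $ j =
    (if j < n - 1 then \<Sum>i = 0..<n. x $ i * laplacian n E $$ (i, j) else \<Sum>i = 0..<n. x $ i)"
  using assms
  by (auto simp: append_ones_def laplacian_del_def scalar_prod_def mult.commute intro!: sum.cong)

section \<open>Points with denominator \<open>n\<close> and congruences modulo
  \<open>n\<close>\<close>

lemma of_int_div_Ints_iff:
  assumes "n \<ge> 1"
  shows "real_of_int a / real n \<in> \<int> \<longleftrightarrow> [a = 0] (mod int n)"
proof
  assume "real_of_int a / real n \<in> \<int>"
  then obtain k where "real_of_int a / real n = real_of_int k"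
    by (auto elim: Ints_cases)
  then have "real_of_int a = real_of_int (k * int n)"
    using assms by (simp add: field_simps)
  then have "a = k * int n"
    by (simp only: of_int_eq_iff)
  then show "[a = 0] (mod int n)"
    by (simp add: cong_0_iff)
next
  assume "[a = 0] (mod int n)"
  then obtain k where "a = int n * k"
    by (auto simp: cong_0_iff)
  then show "real_of_int a / real n \<in> \<int>"
    using assms by simp
qed

text \<open>For coefficients \<open>x $ i / n\<close>, each coordinate of the lifted combination is
  the matching coordinate of the matrix product divided by \<open>n\<close>. Integrality thus
  becomes a congruence, and the range [0,1) becomes the range from 0 to
  \<open>n - 1\<close>.\<close>

lemma scaled_mem_Lambda_iff:
  assumes n: "n \<ge> 1" and x: "x \<in> carrier_vec n"
  shows "(1 / real n) \<cdot>\<^sub>v map_vec real_of_int x \<in> Lambda (n - 1) (laplacian_vertex n E) \<longleftrightarrow>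
    (\<forall>i<n. 0 \<le> x $ i \<and> x $ i < int n) \<and>
    (\<forall>j<n. [(transpose_mat (append_ones (laplacian_del n E)) *\<^sub>v x) $ j = 0] (mod int n))"
    (is "?l \<in> _ \<longleftrightarrow> ?bounds \<and> ?cong")
proof -
  define y where "y = transpose_mat (append_ones (laplacian_del n E)) *\<^sub>v x"
  define l where "l = ?l"
  have n1: "n - 1 + 1 = n" using n by simp
  have l: "l \<in> carrier_vec n" "\<And>i. i < n \<Longrightarrow> l $ i = real_of_int (x $ i) / real n"
    using x by (simp_all add: l_def)
  have coord: "(\<Sum>i = 0..<n. l $ i * laplacian_vertex n E i $ j) = real_of_int (y $ j) / real n"
    if "j < n - 1" for j
  proof -
    have "(\<Sum>i = 0..<n. l $ i * laplacian_vertex n E i $ j) =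
      (\<Sum>i = 0..<n. real_of_int (x $ i * laplacian n E $$ (i, j)) / real n)"
      using that by (intro sum.cong) (auto simp: l index_laplacian_vertex)
    also have "\<dots> = real_of_int (y $ j) / real n"
      using that x n by (simp add: y_def index_transpose_append_ones flip: sum_divide_distrib)
    finally show ?thesis .
  qed
  have total: "(\<Sum>i = 0..<n. l $ i) = real_of_int (y $ (n - 1)) / real n"
  proof -
    have "(\<Sum>i = 0..<n. l $ i) = (\<Sum>i = 0..<n. real_of_int (x $ i) / real n)"
      by (intro sum.cong) (auto simp: l)
    also have "\<dots> = real_of_int (y $ (n - 1)) / real n"
      using x n by (simp add: y_def index_transpose_append_ones flip: sum_divide_distrib)
    finally show ?thesis .
  qed
  have bounds: "(\<forall>i<n. 0 \<le> l $ i \<and> l $ i < 1) \<longleftrightarrow> ?bounds"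
    using n by (auto simp: l zero_le_divide_iff)
  \<comment> \<open>Index \<open>n - 1\<close>, the column of ones, is separated because
    \<open>mem_Lambda_iff\<close> states the condition on the coefficient sum separately.\<close>
  have split: "(\<forall>j<n. P j) \<longleftrightarrow> (\<forall>j<n - 1. P j) \<and> P (n - 1)" for P
    using n by (cases n) (auto simp: All_less_Suc)
  have "l \<in> Lambda (n - 1) (laplacian_vertex n E) \<longleftrightarrow>
      l \<in> carrier_vec n \<and> (\<forall>i<n. 0 \<le> l $ i \<and> l $ i < 1) \<and>
      (\<forall>j<n - 1. (\<Sum>i = 0..<n. l $ i * laplacian_vertex n E i $ j) \<in> \<int>) \<and> (\<Sum>i = 0..<n. l $ i) \<in> \<int>"
    by (rule mem_Lambda_iff[of "n - 1" "laplacian_vertex n E" l, unfolded n1, OF laplacian_vertex_carrier])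
  also have "\<dots> \<longleftrightarrow> ?bounds \<and> (\<forall>j<n - 1. [y $ j = 0] (mod int n)) \<and> [y $ (n - 1) = 0] (mod int n)"
    unfolding bounds total of_int_div_Ints_iff[OF n] using l(1)
    by (simp add: coord of_int_div_Ints_iff[OF n] del: One_nat_def)
  also have "(\<forall>j<n - 1. [y $ j = 0] (mod int n)) \<and> [y $ (n - 1) = 0] (mod int n) \<longleftrightarrow>
      (\<forall>j<n. [y $ j = 0] (mod int n))"
    by (rule split[symmetric])
  finally show ?thesis
    unfolding l_def y_def .
qed

lemma eq_scaled_int_vec:
  assumes "l \<in> carrier_vec n" "n \<ge> 1" "\<And>i. i < n \<Longrightarrow> real n * l $ i \<in> \<int>"
  obtains x :: "int vec" where "x \<in> carrier_vec n" "l = (1 / real n) \<cdot>\<^sub>v map_vec real_of_int x"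
proof
  \<comment> \<open>The floor only converts to type \<open>int\<close>; it leaves the values
    unchanged, since \<open>real n * l $ i\<close> is an integer.\<close>
  let ?x = "vec n (\<lambda>i. \<lfloor>real n * l $ i\<rfloor>)"
  show "?x \<in> carrier_vec n" by simp
  show "l = (1 / real n) \<cdot>\<^sub>v map_vec real_of_int ?x"
    using assms by (intro eq_vecI) (auto simp: of_int_floor)
qed

theorem theorem3p11:
  fixes n :: nat and E :: "nat set set"
  assumes "n \<ge> 1"
    and "simple_graph n E"
    and "connected_graph n E"
    and "reflexive (n - 1) (laplacian_simplex n E)"
  shows "Lambda (n - 1) (laplacian_vertex n E) =
    {(1 / real n) \<cdot>\<^sub>v map_vec real_of_int x | x :: int vec.
       x \<in> carrier_vec n \<and> (\<forall>i<n. 0 \<le> x $ i \<and> x $ i < int n) \<and>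
       (\<forall>j<n. [(transpose_mat (append_ones (laplacian_del n E)) *\<^sub>v x) $ j = 0] (mod int n))}"
proof -
  have d: "n - 1 + 1 = n" using assms(1) by simp
  \<comment> \<open>This is the centering hypothesis of \<open>reflexive_Lambda_integral\<close>,
    taken with \<open>d = n - 1\<close>, so that the factor \<open>d + 1\<close> there is
    \<open>n\<close>.\<close>
  have "(\<Sum>i = 0..<n. laplacian_vertex n E i $ j) = 0" if "j < n - 1" for j
  proof -
    have "(\<Sum>i = 0..<n. laplacian_vertex n E i $ j) = real_of_int (\<Sum>i = 0..<n. laplacian n E $$ (i, j))"
      using that by (simp add: index_laplacian_vertex)
    then show ?thesis
      using that sum_column_laplacian[OF assms(2)] by simp
  qed
  then have integral: "real n * l $ i \<in> \<int>"
    if "l \<in> Lambda (n - 1) (laplacian_vertex n E)" "i < n" for l i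
    using reflexive_Lambda_integral[of "n - 1" "laplacian_vertex n E" l i] that assms(4)
      laplacian_vertex_carrier unfolding d laplacian_simplex_def by blast
  \<comment> \<open>Reflexivity enters through \<open>integral\<close>: every point of
    \<open>Lambda\<close> has the form \<open>x / n\<close>. Among points of this form
    \<open>scaled_mem_Lambda_iff\<close> decides membership, which yields both inclusions.\<close>
  have "\<exists>x :: int vec. x \<in> carrier_vec n \<and> l = (1 / real n) \<cdot>\<^sub>v map_vec real_of_int x"
    if "l \<in> Lambda (n - 1) (laplacian_vertex n E)" for l
  proof -
    have "l \<in> carrier_vec n"
      using that unfolding Lambda_def d by blast
    then show ?thesis
      using eq_scaled_int_vec assms(1) integral[OF that] by metis
  qed
  then show ?thesis
    using scaled_mem_Lambda_iff[OF assms(1)] by blast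
qed

end
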